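(* Let $\mathcal{A}$ be a unital Banach algebra and let $a,b,c\in\mathcal{A}$ be such that $b$ and $c$ are regular. The following statements hold. (i) If $a^{-(b,c)}$ exists, then $L_{a^{-(b,c)}}=L_a^{-(L_b,L_c)}=(L_a)^{(2)}_{b\mathcal{A},\,c^{-1}(0)}\in\mathcal{L}(\mathcal{A})$. (ii) Suppose that $L_a^{-(L_b,L_c)}=(L_a)^{(2)}_{b\mathcal{A},\,c^{-1}(0)}\in\mathcal{L}(\mathcal{A})$ exists and there is $z\in\mathcal{A}$ such that $(L_a)^{(2)}_{b\mathcal{A},\,c^{-1}(0)}=L_z$. Then $a^{-(b,c)}$ exists and $a^{-(b,c)}=z$. (iii) If $a^{-(b,c)}$ exists, then $R_{a^{-(b,c)}}=R_a^{-(R_c,R_b)}=(R_a)^{(2)}_{\mathcal{A}c,\,b_{-1}(0)}\in\mathcal{L}(\mathcal{A})$. (iv) Suppose that $R_a^{-(R_c,R_b)}=(R_a)^{(2)}_{\mathcal{A}c,\,b_{-1}(0)}\in\mathcal{L}(\mathcal{A})$ exists and there is $w\in\mathcal{A}$ such that $(R_a)^{(2)}_{\mathcal{A}c,\,b_{-1}(0)}=R_w$. Then $a^{-(b,c)}$ exists and $a^{-(b,c)}=w$.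
   Context: For $x\in\mathcal{A}$, $L_x,R_x\in\mathcal{L}(\mathcal{A})$ are $L_x(z)=xz$ and $R_x(z)=zx$; $x\mathcal{A}=\mathcal{R}(L_x)$, $x^{-1}(0)=\mathcal{N}(L_x)=\{z: xz=0\}$, $\mathcal{A}x=\mathcal{R}(R_x)$, $x_{-1}(0)=\mathcal{N}(R_x)=\{z: zx=0\}$, where $\mathcal{R}$ and $\mathcal{N}$ denote range and null space. An element $x$ of a unital algebra $\mathcal{B}$ is regular if $x=xyx$ for some $y\in\mathcal{B}$. For $b,c\in\mathcal{B}$, an element $a\in\mathcal{B}$ is $(b,c)$-invertible if there exists $y\in\mathcal{B}$ such that $y\in (b\mathcal{B}y)\cap(y\mathcal{B}c)$, $b=yab$ and $c=cay$; such $y$ is unique when it exists and is denoted $a^{-(b,c)}$ (this is used both in $\mathcal{B}=\mathcal{A}$ and in $\mathcal{B}=\mathcal{L}(\mathcal{A})$). For a Banach space $\mathcal{X}$, $A\in\mathcal{L}(\mathcal{X})$ and closed subspaces $\mathcal{T},\mathcal{S}\subseteq\mathcal{X}$, the outer inverse $A^{(2)}_{\mathcal{T},\mathcal{S}}$ is the (necessarily unique, if it exists) operator $Y\in\mathcal{L}(\mathcal{X})$ with $YAY=Y$, $\mathcal{R}(Y)=\mathcal{T}$, $\mathcal{N}(Y)=\mathcal{S}$. For regular $b,c$, the existence of $L_a^{-(L_b,L_c)}$ is equivalent to that of $(L_a)^{(2)}_{b\mathcal{A},c^{-1}(0)}$, in which case they coincide; likewise for $R_a^{-(R_c,R_b)}$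 and $(R_a)^{(2)}_{\mathcal{A}c,b_{-1}(0)}$. *)

theory Defs
  imports "HOL-Analysis.Analysis"
begin

text \<open>
  A unital Banach algebra over the field \<open>'k\<close> of scalars, which is \<open>real\<close> or \<open>complex\<close>:
  a complete \<open>real_normed_field\<close> is one of these. The library classes only know
  the real scalar multiplication, so the scalar action of \<open>'k\<close> is a parameter that extends it.
  The sort with \<open>monoid_mult\<close> in place of \<open>real_normed_algebra_1\<close> avoids
  the normalisation \<open>norm 1 = 1\<close>.
\<close>

locale unital_banach_algebra = vector_space smul
  for smul :: "'k::{real_normed_field,complete_space} \<Rightarrow>
    'a::{real_normed_algebra,monoid_mult,banach} \<Rightarrow> 'a" +
  assumes smul_of_real: "smul (of_real r) x = r *\<^sub>R x"
    and norm_smul: "norm (smul k x) = norm k * norm x"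
    and smul_mult_left: "smul k x * y = smul k (x * y)"
    and smul_mult_right: "x * smul k y = smul k (x * y)"

lemma unital_banach_algebra_scaleR:
  "unital_banach_algebra
    (scaleR :: real \<Rightarrow> 'a::{real_normed_algebra,monoid_mult,banach} \<Rightarrow> 'a)"
  by unfold_locales (simp_all add: scaleR_add_right scaleR_add_left)

lemma unital_banach_algebra_complex:
  "unital_banach_algebra ((*) :: complex \<Rightarrow> complex \<Rightarrow> complex)"
  by unfold_locales (simp_all add: algebra_simps norm_mult scaleR_conv_of_real)

text \<open>
  \<open>\<L>(X)\<close>: the members of \<open>'a \<Rightarrow>\<^sub>L 'a\<close> are the bounded real-linear operators; those that are
  linear over \<open>'k\<close> are singled out.
\<close>

definition bounded_operators ::
  "('k \<Rightarrow> 'a::real_normed_vector \<Rightarrow> 'a) \<Rightarrow> ('a \<Rightarrow>\<^sub>L 'a) set" where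
  "bounded_operators smul =
    {T. \<forall>k x. blinfun_apply T (smul k x) = smul k (blinfun_apply T x)}"

text \<open>
  The library names the multiplication operators after the position of the variable argument,
  so \<open>L\<^sub>x\<close> is \<open>blinfun_mult_right x\<close>.
\<close>

abbreviation left_mult :: "'a::real_normed_algebra \<Rightarrow> 'a \<Rightarrow>\<^sub>L 'a" where
  "left_mult x \<equiv> blinfun_mult_right x"

abbreviation right_mult :: "'a::real_normed_algebra \<Rightarrow> 'a \<Rightarrow>\<^sub>L 'a" where
  "right_mult x \<equiv> blinfun_mult_left x"

definition op_range :: "('a::real_normed_vector \<Rightarrow>\<^sub>L 'a) \<Rightarrow> 'a set" where
  "op_range T = range (blinfun_apply T)"

definition op_null :: "('a::real_normed_vector \<Rightarrow>\<^sub>L 'a) \<Rightarrow> 'a set" where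
  "op_null T = {z. blinfun_apply T z = 0}"

definition regular_element :: "'a::times \<Rightarrow> bool" where
  "regular_element x \<longleftrightarrow> (\<exists>y. x = x * y * x)"

text \<open>
  The \<open>(b,c)\<close>-inverse \<open>y\<close> of \<open>a\<close> in an algebra with carrier \<open>B\<close> and multiplication \<open>m\<close>.
  Both are explicit because the notion is used in a Banach algebra and in \<open>\<L>(X)\<close>,
  which is not an instance of the ring classes.
\<close>

definition is_bc_inverse ::
  "'b set \<Rightarrow> ('b \<Rightarrow> 'b \<Rightarrow> 'b) \<Rightarrow> 'b \<Rightarrow> 'b \<Rightarrow> 'b \<Rightarrow> 'b \<Rightarrow> bool" where
  "is_bc_inverse B m b c a y \<longleftrightarrow>
    y \<in> B \<and>
    y \<in> {m (m b u) y | u. u \<in> B} \<inter> {m (m y u) c | u. u \<in> B} \<and>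
    b = m (m y a) b \<and> c = m (m c a) y"

definition bc_invertible ::
  "'b set \<Rightarrow> ('b \<Rightarrow> 'b \<Rightarrow> 'b) \<Rightarrow> 'b \<Rightarrow> 'b \<Rightarrow> 'b \<Rightarrow> bool" where
  "bc_invertible B m b c a \<longleftrightarrow> (\<exists>y. is_bc_inverse B m b c a y)"

definition bc_inverse ::
  "'b set \<Rightarrow> ('b \<Rightarrow> 'b \<Rightarrow> 'b) \<Rightarrow> 'b \<Rightarrow> 'b \<Rightarrow> 'b \<Rightarrow> 'b" where
  "bc_inverse B m b c a = (THE y. is_bc_inverse B m b c a y)"

abbreviation alg_bc_invertible :: "'a::times \<Rightarrow> 'a \<Rightarrow> 'a \<Rightarrow> bool" where
  "alg_bc_invertible \<equiv> bc_invertible UNIV (*)"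

abbreviation alg_bc_inverse :: "'a::times \<Rightarrow> 'a \<Rightarrow> 'a \<Rightarrow> 'a" where
  "alg_bc_inverse \<equiv> bc_inverse UNIV (*)"

abbreviation op_bc_invertible :: "('k \<Rightarrow> 'a::real_normed_vector \<Rightarrow> 'a) \<Rightarrow>
    ('a \<Rightarrow>\<^sub>L 'a) \<Rightarrow> ('a \<Rightarrow>\<^sub>L 'a) \<Rightarrow> ('a \<Rightarrow>\<^sub>L 'a) \<Rightarrow> bool" where
  "op_bc_invertible smul \<equiv> bc_invertible (bounded_operators smul) (o\<^sub>L)"

abbreviation op_bc_inverse :: "('k \<Rightarrow> 'a::real_normed_vector \<Rightarrow> 'a) \<Rightarrow>
    ('a \<Rightarrow>\<^sub>L 'a) \<Rightarrow> ('a \<Rightarrow>\<^sub>L 'a) \<Rightarrow> ('a \<Rightarrow>\<^sub>L 'a) \<Rightarrow> 'a \<Rightarrow>\<^sub>L 'a" where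
  "op_bc_inverse smul \<equiv> bc_inverse (bounded_operators smul) (o\<^sub>L)"

text \<open>
  \<open>A\<^sup>(\<^sup>2\<^sup>)\<^sub>T\<^sub>,\<^sub>S\<close>, the outer inverse of \<open>A\<close> with range \<open>T\<close> and null space \<open>S\<close>.
\<close>

definition is_outer_inverse :: "('k::field \<Rightarrow> 'a::banach \<Rightarrow> 'a) \<Rightarrow>
    ('a \<Rightarrow>\<^sub>L 'a) \<Rightarrow> 'a set \<Rightarrow> 'a set \<Rightarrow> ('a \<Rightarrow>\<^sub>L 'a) \<Rightarrow> bool" where
  "is_outer_inverse smul A T S Y \<longleftrightarrow>
    module.subspace smul T \<and> closed T \<and> module.subspace smul S \<and> closed S \<and>
    Y \<in> bounded_operators smul \<and> Y o\<^sub>L A o\<^sub>L Y = Y \<and> op_range Y = T \<and> op_null Y = S"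

definition outer_invertible :: "('k::field \<Rightarrow> 'a::banach \<Rightarrow> 'a) \<Rightarrow>
    ('a \<Rightarrow>\<^sub>L 'a) \<Rightarrow> 'a set \<Rightarrow> 'a set \<Rightarrow> bool" where
  "outer_invertible smul A T S \<longleftrightarrow> (\<exists>Y. is_outer_inverse smul A T S Y)"

definition outer_inverse :: "('k::field \<Rightarrow> 'a::banach \<Rightarrow> 'a) \<Rightarrow>
    ('a \<Rightarrow>\<^sub>L 'a) \<Rightarrow> 'a set \<Rightarrow> 'a set \<Rightarrow> 'a \<Rightarrow>\<^sub>L 'a" where
  "outer_inverse smul A T S = (THE Y. is_outer_inverse smul A T S Y)"

end

theory Submission
  imports Defs
begin

text \<open>
  A \<open>(b,c)\<close>-inverse is unique in any associative structure, and in \<open>\<L>(X)\<close> a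
  \<open>(B,C)\<close>-inverse of \<open>A\<close> is an outer inverse with range \<open>\<R>(B)\<close> and null space \<open>\<N>(C)\<close>.
  Since \<open>x \<mapsto> L\<^sub>x\<close> is a homomorphism and \<open>x \<mapsto> R\<^sub>x\<close> an anti-homomorphism, both injective because of
  the unit, \<open>(b,c)\<close>-inverses pass to the multiplication operators. Conversely, the
  operator witnesses of \<open>L\<^sub>z \<in> L\<^sub>b \<L>(\<A>) L\<^sub>z \<inter> L\<^sub>z \<L>(\<A>) L\<^sub>c\<close> need not be multiplication operators,
  but inner inverses of \<open>b\<close> and \<open>c\<close> can replace them.
\<close>

section \<open>Uniqueness of \<open>(b,c)\<close>-inverses and of outer inverses\<close>

text \<open>Both inverses equal the product \<open>y a y'\<close>: replace \<open>c\<close> by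
  \<open>c a y'\<close> in \<open>y = y v c\<close>, and \<open>y a b\<close> by \<open>b\<close>
  after inserting \<open>y' = b u y'\<close>.\<close>

lemma is_bc_inverse_unique:
  assumes assoc: "\<And>p q r. m (m p q) r = m p (m q r)"
    and y: "is_bc_inverse B m b c a y" and y': "is_bc_inverse B m b c a y'"
  shows "y = y'"
proof -
  obtain v where v: "y = m (m y v) c"
    using y unfolding is_bc_inverse_def by blast
  obtain u where u: "y' = m (m b u) y'"
    using y' unfolding is_bc_inverse_def by blast
  have c: "c = m (m c a) y'" and b: "b = m (m y a) b"
    using y y' unfolding is_bc_inverse_def by blast+
  have "y = m (m y v) (m (m c a) y')"
    using v c by simp
  also have "\<dots> = m (m (m (m y v) c) a) y'"
    by (simp add: assoc)
  also have "\<dots> = m (m y a) y'"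
    using v by simp
  also have "\<dots> = m (m y a) (m (m b u) y')"
    using u by simp
  also have "\<dots> = m (m (m (m y a) b) u) y'"
    by (simp add: assoc)
  also have "\<dots> = y'"
    using b u by simp
  finally show ?thesis .
qed

lemma bc_inverse_eqI:
  assumes "\<And>p q r. m (m p q) r = m p (m q r)" and "is_bc_inverse B m b c a y"
  shows "bc_inverse B m b c a = y"
  unfolding bc_inverse_def using is_bc_inverse_unique[OF assms(1)] assms(2) by blast

lemma is_bc_inverse_bc_inverse:
  assumes "\<And>p q r. m (m p q) r = m p (m q r)" and "bc_invertible B m b c a"
  shows "is_bc_inverse B m b c a (bc_inverse B m b c a)"
  using assms bc_inverse_eqI[OF assms(1)] unfolding bc_invertible_def by metis

text \<open>The range of \<open>1 - A Z\<close> lies in the common null space, so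
  \<open>Y = Y A Z\<close>; and \<open>Y A\<close> fixes the common range, which contains every
  \<open>Z x\<close>.\<close>

lemma is_outer_inverse_unique:
  assumes Y: "is_outer_inverse smul A T S Y" and Z: "is_outer_inverse smul A T S Z"
  shows "Y = Z"
proof (rule blinfun_eqI)
  fix x
  have YAY: "Y (A (Y w)) = Y w" and ZAZ: "Z (A (Z w)) = Z w" for w
    using Y Z unfolding is_outer_inverse_def by (metis blinfun_apply_blinfun_compose)+
  have "x - A (Z x) \<in> op_null Z"
    by (simp add: op_null_def blinfun.diff_right ZAZ)
  then have "x - A (Z x) \<in> op_null Y"
    using Y Z unfolding is_outer_inverse_def by simp
  then have "Y x = Y (A (Z x))"
    by (simp add: op_null_def blinfun.diff_right)
  moreover have "Z x \<in> op_range Y"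
    using Y Z unfolding is_outer_inverse_def op_range_def by auto
  then have "Y (A (Z x)) = Z x"
    unfolding op_range_def using YAY by auto
  ultimately show "Y x = Z x"
    by simp
qed

lemma outer_inverse_eqI:
  assumes "is_outer_inverse smul A T S Y"
  shows "outer_inverse smul A T S = Y"
  unfolding outer_inverse_def using is_outer_inverse_unique assms by blast

section \<open>Operator \<open>(B,C)\<close>-inverses as outer inverses\<close>

lemma blinfun_compose_assoc: "(P o\<^sub>L Q) o\<^sub>L R = P o\<^sub>L (Q o\<^sub>L R)"
  by (rule blinfun_eqI) simp

lemma closed_op_null: "closed (op_null T)"
  unfolding op_null_def by (intro closed_Collect_eq continuous_intros)

context unital_banach_algebra
begin

lemma subspace_op_null:
  assumes "T \<in> bounded_operators smul"
  shows "subspace (op_null T)"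
  using assms unfolding subspace_def op_null_def bounded_operators_def
  by (simp add: blinfun.add_right)

lemma subspace_op_range:
  assumes "T \<in> bounded_operators smul"
  shows "subspace (op_range T)"
proof (rule subspaceI)
  show "0 \<in> op_range T"
    unfolding op_range_def by (metis blinfun.zero_right rangeI)
  show "x + y \<in> op_range T" if "x \<in> op_range T" "y \<in> op_range T" for x y
    using that unfolding op_range_def by (auto simp flip: blinfun.add_right)
  show "smul k x \<in> op_range T" if "x \<in> op_range T" for k x
    using that assms unfolding op_range_def bounded_operators_def by (auto simp: image_iff) metis
qed

text \<open>Each of the four equations gives one inclusion: \<open>Y = B U Y\<close> and
  \<open>B = Y A B\<close> compare the ranges, \<open>Y = Y V C\<close> and \<open>C = C A Y\<close>
  the null spaces.\<close>

lemma is_bc_inverse_imp_is_outer_inverse: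
  assumes B: "B \<in> bounded_operators smul" and C: "C \<in> bounded_operators smul"
    and Y: "is_bc_inverse (bounded_operators smul) (o\<^sub>L) B C A Y"
  shows "is_outer_inverse smul A (op_range B) (op_null C) Y"
proof -
  obtain U V where "Y = B o\<^sub>L U o\<^sub>L Y" "Y = Y o\<^sub>L V o\<^sub>L C"
    using Y unfolding is_bc_inverse_def by blast
  then have U: "Y x = B (U (Y x))" and V: "Y x = Y (V (C x))" for x
    by (metis blinfun_apply_blinfun_compose)+
  have "B = Y o\<^sub>L A o\<^sub>L B" "C = C o\<^sub>L A o\<^sub>L Y"
    using Y unfolding is_bc_inverse_def by blast+
  then have B': "B x = Y (A (B x))" and C': "C x = C (A (Y x))" for x
    by (metis blinfun_apply_blinfun_compose)+
  \<comment> \<open>By \<open>U\<close>, \<open>Y x\<close> lies in the range of \<open>B\<close>,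
    which \<open>Y A\<close> fixes by \<open>B'\<close>.\<close>
  have YAY: "Y (A (Y x)) = Y x" for x
    by (metis B' U)
  have range: "op_range Y = op_range B"
    unfolding op_range_def using U B' by (auto simp: image_iff)
  have null: "op_null Y = op_null C"
    unfolding op_null_def using V C' by (metis blinfun.zero_right)
  \<comment> \<open>\<open>Y A\<close> is a bounded projection onto \<open>\<R>(Y)\<close>, which makes the range closed.\<close>
  have "op_range Y = op_null (id_blinfun - (Y o\<^sub>L A))"
    unfolding op_range_def op_null_def
    by (auto simp: blinfun.diff_left YAY)
  then have "closed (op_range B)"
    using closed_op_null range by metis
  moreover have "Y o\<^sub>L A o\<^sub>L Y = Y"
    by (rule blinfun_eqI) (simp add: YAY)
  ultimately show ?thesis
    using Y null range closed_op_null subspace_op_range[OF B] subspace_op_null[OF C]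
    unfolding is_outer_inverse_def is_bc_inverse_def by simp
qed

text \<open>The conclusion has the shape of parts (i) and (iii), so that each becomes an instance
  with \<open>Y\<close> a multiplication operator.\<close>

lemma op_bc_inverse_eq_outer_inverse:
  assumes "B \<in> bounded_operators smul" and "C \<in> bounded_operators smul"
    and Y: "is_bc_inverse (bounded_operators smul) (o\<^sub>L) B C A Y"
  shows "op_bc_invertible smul B C A \<and> outer_invertible smul A (op_range B) (op_null C) \<and>
    Y = op_bc_inverse smul B C A \<and>
    op_bc_inverse smul B C A = outer_inverse smul A (op_range B) (op_null C) \<and>
    outer_inverse smul A (op_range B) (op_null C) \<in> bounded_operators smul"
proof -
  have outer: "is_outer_inverse smul A (op_range B) (op_null C) Y"
    using assms by (rule is_bc_inverse_imp_is_outer_inverse)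
  show ?thesis
    using Y outer bc_inverse_eqI[OF blinfun_compose_assoc Y] outer_inverse_eqI[OF outer]
    unfolding bc_invertible_def outer_invertible_def
    by (auto simp: is_outer_inverse_def)
qed

section \<open>Transfer between elements and multiplication operators\<close>

lemma left_mult_in_bounded_operators: "left_mult x \<in> bounded_operators smul"
  by (simp add: bounded_operators_def smul_mult_right)

lemma right_mult_in_bounded_operators: "right_mult x \<in> bounded_operators smul"
  by (simp add: bounded_operators_def smul_mult_left)

lemma is_bc_inverse_left_mult_iff:
  assumes "regular_element b" and "regular_element c"
  shows "is_bc_inverse (bounded_operators smul) (o\<^sub>L) (left_mult b) (left_mult c) (left_mult a)
      (left_mult z) \<longleftrightarrow> is_bc_inverse UNIV (*) b c a z" (is "?L \<longleftrightarrow> ?R")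
proof
  assume z: ?R
  obtain u v where u: "z = b * u * z" and v: "z = z * v * c"
    using z unfolding is_bc_inverse_def by blast
  have b: "b = z * a * b" and c: "c = c * a * z"
    using z unfolding is_bc_inverse_def by blast+
  have mult: "left_mult (x * y) = left_mult x o\<^sub>L left_mult y" for x y :: 'a
    by (rule blinfun_eqI) (simp add: mult.assoc)
  have "left_mult z = left_mult b o\<^sub>L left_mult u o\<^sub>L left_mult z"
    and "left_mult z = left_mult z o\<^sub>L left_mult v o\<^sub>L left_mult c"
    and "left_mult b = left_mult z o\<^sub>L left_mult a o\<^sub>L left_mult b"
    and "left_mult c = left_mult c o\<^sub>L left_mult a o\<^sub>L left_mult z"
    using u v b c by (simp_all flip: mult)
  then show ?L
    unfolding is_bc_inverse_def using left_mult_in_bounded_operators by blast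
next
  assume z: ?L
  obtain U V where U: "left_mult z = left_mult b o\<^sub>L U o\<^sub>L left_mult z"
    and V: "left_mult z = left_mult z o\<^sub>L V o\<^sub>L left_mult c"
    using z unfolding is_bc_inverse_def by blast
  have "left_mult b = left_mult z o\<^sub>L left_mult a o\<^sub>L left_mult b"
    and "left_mult c = left_mult c o\<^sub>L left_mult a o\<^sub>L left_mult z"
    using z unfolding is_bc_inverse_def by blast+
  \<comment> \<open>Evaluation at the unit recovers an element from its multiplication
    operator.\<close>
  from this[THEN arg_cong[where f = "\<lambda>T. blinfun_apply T 1"]]
  have b: "b = z * a * b" and c: "c = c * a * z"
    by (simp_all add: mult.assoc)
  obtain p q where p: "b = b * p * b" and q: "c = c * q * c"
    using assms unfolding regular_element_def by blast
  have U1: "z = b * U z"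
    using arg_cong[OF U, where f = "\<lambda>T. blinfun_apply T 1"] by simp
  have V1: "z * x = z * V (c * x)" for x
    using arg_cong[OF V, where f = "\<lambda>T. blinfun_apply T x"] by simp
  \<comment> \<open>By \<open>U1\<close>, \<open>z\<close> is a left multiple of \<open>b\<close>,
    and \<open>b * p\<close> fixes all of these.\<close>
  have "z = b * p * z"
    using U1 p by (metis mult.assoc)
  \<comment> \<open>Since \<open>c * (q * c) = c\<close>, the arguments \<open>1\<close> and
    \<open>q * c\<close> of \<open>V1\<close> yield the same value \<open>z * V c\<close>.\<close>
  moreover have "z = z * q * c"
    using V1[of 1] V1[of "q * c"] q by (simp add: mult.assoc)
  ultimately show ?R
    using b c unfolding is_bc_inverse_def by blast
qed

text \<open>Right multiplication reverses products, so \<open>b\<close> and \<open>c\<close> change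
  places: \<open>c\<close> now governs the range and \<open>b\<close> the null space.\<close>

lemma is_bc_inverse_right_mult_iff:
  assumes "regular_element b" and "regular_element c"
  shows "is_bc_inverse (bounded_operators smul) (o\<^sub>L) (right_mult c) (right_mult b) (right_mult a)
      (right_mult z) \<longleftrightarrow> is_bc_inverse UNIV (*) b c a z" (is "?L \<longleftrightarrow> ?R")
proof
  assume z: ?R
  \<comment> \<open>Bracketing to the right turns into compositions bracketed to the left, as
    \<open>is_bc_inverse\<close> has them.\<close>
  obtain u v where u: "z = b * (u * z)" and v: "z = z * (v * c)"
    using z unfolding is_bc_inverse_def by (auto simp: mult.assoc)
  have b: "b = z * (a * b)" and c: "c = c * (a * z)"
    using z unfolding is_bc_inverse_def by (simp_all add: mult.assoc)
  have mult: "right_mult (y * x) = right_mult x o\<^sub>L right_mult y" for x y :: 'a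
    by (rule blinfun_eqI) (simp add: mult.assoc)
  have "right_mult z = right_mult c o\<^sub>L right_mult v o\<^sub>L right_mult z"
    and "right_mult z = right_mult z o\<^sub>L right_mult u o\<^sub>L right_mult b"
    and "right_mult c = right_mult z o\<^sub>L right_mult a o\<^sub>L right_mult c"
    and "right_mult b = right_mult b o\<^sub>L right_mult a o\<^sub>L right_mult z"
    using u v b c by (simp_all flip: mult)
  then show ?L
    unfolding is_bc_inverse_def using right_mult_in_bounded_operators by blast
next
  assume z: ?L
  obtain U V where U: "right_mult z = right_mult c o\<^sub>L U o\<^sub>L right_mult z"
    and V: "right_mult z = right_mult z o\<^sub>L V o\<^sub>L right_mult b"
    using z unfolding is_bc_inverse_def by blast
  have "right_mult b = right_mult b o\<^sub>L right_mult a o\<^sub>L right_mult z"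
    and "right_mult c = right_mult z o\<^sub>L right_mult a o\<^sub>L right_mult c"
    using z unfolding is_bc_inverse_def by blast+
  from this[THEN arg_cong[where f = "\<lambda>T. blinfun_apply T 1"]]
  have b: "b = z * a * b" and c: "c = c * a * z"
    by (simp_all add: mult.assoc)
  obtain p q where p: "b = b * p * b" and q: "c = c * q * c"
    using assms unfolding regular_element_def by blast
  have U1: "z = U z * c"
    using arg_cong[OF U, where f = "\<lambda>T. blinfun_apply T 1"] by simp
  have V1: "x * z = V (x * b) * z" for x
    using arg_cong[OF V, where f = "\<lambda>T. blinfun_apply T x"] by simp
  have "z = z * q * c"
    using U1 q by (metis mult.assoc)
  \<comment> \<open>Here \<open>V1\<close> at \<open>1\<close> and at \<open>b * p\<close> gives
    \<open>V b * z\<close> both times, because \<open>b * p * b = b\<close>.\<close>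
  moreover have "z = b * p * z"
    using V1[of 1] V1[of "b * p"] p by (simp add: mult.assoc)
  ultimately show ?R
    using b c unfolding is_bc_inverse_def by blast
qed

end

theorem proposition3p9:
  fixes smul :: "'k::{real_normed_field,complete_space} \<Rightarrow>
      'a::{real_normed_algebra,monoid_mult,banach} \<Rightarrow> 'a"
    and a b c :: 'a
  assumes "unital_banach_algebra smul"
    and "regular_element b" and "regular_element c"
  shows
    "(alg_bc_invertible b c a \<longrightarrow>
        op_bc_invertible smul (left_mult b) (left_mult c) (left_mult a) \<and>
        outer_invertible smul (left_mult a) (op_range (left_mult b)) (op_null (left_mult c)) \<and>
        left_mult (alg_bc_inverse b c a) =
          op_bc_inverse smul (left_mult b) (left_mult c) (left_mult a) \<and>
        op_bc_inverse smul (left_mult b) (left_mult c) (left_mult a) =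
          outer_inverse smul (left_mult a) (op_range (left_mult b)) (op_null (left_mult c)) \<and>
        outer_inverse smul (left_mult a) (op_range (left_mult b)) (op_null (left_mult c))
          \<in> bounded_operators smul) \<and>
     (\<forall>z. op_bc_invertible smul (left_mult b) (left_mult c) (left_mult a) \<and>
        outer_invertible smul (left_mult a) (op_range (left_mult b)) (op_null (left_mult c)) \<and>
        op_bc_inverse smul (left_mult b) (left_mult c) (left_mult a) =
          outer_inverse smul (left_mult a) (op_range (left_mult b)) (op_null (left_mult c)) \<and>
        outer_inverse smul (left_mult a) (op_range (left_mult b)) (op_null (left_mult c)) =
          left_mult z \<longrightarrow>
        alg_bc_invertible b c a \<and> alg_bc_inverse b c a = z) \<and>
     (alg_bc_invertible b c a \<longrightarrow>
        op_bc_invertible smul (right_mult c) (right_mult b) (right_mult a) \<and>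
        outer_invertible smul (right_mult a) (op_range (right_mult c)) (op_null (right_mult b)) \<and>
        right_mult (alg_bc_inverse b c a) =
          op_bc_inverse smul (right_mult c) (right_mult b) (right_mult a) \<and>
        op_bc_inverse smul (right_mult c) (right_mult b) (right_mult a) =
          outer_inverse smul (right_mult a) (op_range (right_mult c)) (op_null (right_mult b)) \<and>
        outer_inverse smul (right_mult a) (op_range (right_mult c)) (op_null (right_mult b))
          \<in> bounded_operators smul) \<and>
     (\<forall>w. op_bc_invertible smul (right_mult c) (right_mult b) (right_mult a) \<and>
        outer_invertible smul (right_mult a) (op_range (right_mult c)) (op_null (right_mult b)) \<and>
        op_bc_inverse smul (right_mult c) (right_mult b) (right_mult a) =
          outer_inverse smul (right_mult a) (op_range (right_mult c)) (op_null (right_mult b)) \<and>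
        outer_inverse smul (right_mult a) (op_range (right_mult c)) (op_null (right_mult b)) =
          right_mult w \<longrightarrow>
        alg_bc_invertible b c a \<and> alg_bc_inverse b c a = w)"
proof -
  interpret unital_banach_algebra smul by fact
  note L_iff = is_bc_inverse_left_mult_iff[OF assms(2,3)]
    and R_iff = is_bc_inverse_right_mult_iff[OF assms(2,3)]
  have alg: "alg_bc_invertible b c a \<and> alg_bc_inverse b c a = y" if "is_bc_inverse UNIV (*) b c a y" for y
    using that bc_inverse_eqI[OF mult.assoc that] unfolding bc_invertible_def by blast
  have y: "is_bc_inverse UNIV (*) b c a (alg_bc_inverse b c a)" if "alg_bc_invertible b c a"
    using mult.assoc that by (rule is_bc_inverse_bc_inverse)
  have op: "is_bc_inverse (bounded_operators smul) (o\<^sub>L) B C A (op_bc_inverse smul B C A)"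
    if "op_bc_invertible smul B C A" for A B C
    using blinfun_compose_assoc that by (rule is_bc_inverse_bc_inverse)
  \<comment> \<open>Both facts keep the premise \<open>alg_bc_invertible b c a\<close> of
    \<open>y\<close>, which becomes the antecedent of (i) and (iii).\<close>
  note part_i = op_bc_inverse_eq_outer_inverse[OF left_mult_in_bounded_operators
      left_mult_in_bounded_operators L_iff[THEN iffD2, OF y]]
    and part_iii = op_bc_inverse_eq_outer_inverse[OF right_mult_in_bounded_operators
      right_mult_in_bounded_operators R_iff[THEN iffD2, OF y]]
  \<comment> \<open>The hypotheses of (ii) make the operator \<open>(b,c)\<close>-inverse itself
    equal to \<open>left_mult z\<close>, so \<open>L_iff\<close> turns \<open>z\<close> into a
    \<open>(b,c)\<close>-inverse of \<open>a\<close>.\<close>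
  have part_ii: "alg_bc_invertible b c a \<and> alg_bc_inverse b c a = z"
    if "op_bc_invertible smul (left_mult b) (left_mult c) (left_mult a)"
      and "op_bc_inverse smul (left_mult b) (left_mult c) (left_mult a) = left_mult z" for z
    using op[OF that(1)] that(2) L_iff alg by metis
  have part_iv: "alg_bc_invertible b c a \<and> alg_bc_inverse b c a = w"
    if "op_bc_invertible smul (right_mult c) (right_mult b) (right_mult a)"
      and "op_bc_inverse smul (right_mult c) (right_mult b) (right_mult a) = right_mult w" for w
    using op[OF that(1)] that(2) R_iff alg by metis
  show ?thesis
  proof (rule conjI[OF _ conjI[OF _ conjI]], goal_cases)
    case 1
    show ?case
      using part_i by (rule impI)
  next
    case 2
    show ?case
      using part_ii by (intro allI impI) metis
  next
    case 3
    show ?case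
      using part_iii by (rule impI)
  next
    case 4
    show ?case
      using part_iv by (intro allI impI) metis
  qed
qed

end
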